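(* Let $G$ be a (possibly infinite) chordal graph and let $r\ge 3$ be an integer. Then $B_{r/2}(X)$ is chordal for every vertex set $X\subseteq V(G)$ that induces a connected subgraph of $G$.
   Context: A graph is chordal if every cycle of length at least $4$ has a chord. For a vertex $v$, $B_{r/2}(v)=B_G(v,r/2)$ is the subgraph of $G$ consisting of all vertices at distance at most $r/2$ from $v$ and all edges of $G$ for which the sum of the distances of its endpoints to $v$ is strictly less than $r$. For $X\subseteq V(G)$, $B_{r/2}(X)=\bigcup_{v\in X}B_{r/2}(v)$. *)

theory Defs
  imports Main "HOL-Library.Extended_Nat"
begin

text \<open>Undirected graphs, possibly infinite, with edges encoded as two-element sets of vertices.\<close>

record 'a graph =
  verts :: "'a set"
  edges :: "'a set set"

definition simple_graph :: "'a graph \<Rightarrow> bool" where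
  "simple_graph G \<longleftrightarrow>
     (\<forall>e\<in>edges G. \<exists>u\<in>verts G. \<exists>w\<in>verts G. u \<noteq> w \<and> e = {u, w})"

definition induced_subgraph :: "'a graph \<Rightarrow> 'a set \<Rightarrow> 'a graph" where
  "induced_subgraph G X = \<lparr>verts = verts G \<inter> X, edges = {e \<in> edges G. e \<subseteq> X}\<rparr>"

definition graph_Union :: "'a graph set \<Rightarrow> 'a graph" where
  "graph_Union \<G> = \<lparr>verts = (\<Union>H\<in>\<G>. verts H), edges = (\<Union>H\<in>\<G>. edges H)\<rparr>"

definition is_path :: "'a graph \<Rightarrow> 'a \<Rightarrow> 'a list \<Rightarrow> 'a \<Rightarrow> bool" where
  "is_path G u p w \<longleftrightarrow>
     p \<noteq> [] \<and> hd p = u \<and> last p = w \<and> distinct p \<and> set p \<subseteq> verts G \<and>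
     successively (\<lambda>x y. {x, y} \<in> edges G) p"

text \<open>The graph without vertices counts as connected here.\<close>

definition connected_graph :: "'a graph \<Rightarrow> bool" where
  "connected_graph G \<longleftrightarrow> (\<forall>u\<in>verts G. \<forall>w\<in>verts G. \<exists>p. is_path G u p w)"

text \<open>The distance is \<open>\<infinity>\<close> if there is no path, since the infimum of the empty set
  is the top element.\<close>

definition graph_dist :: "'a graph \<Rightarrow> 'a \<Rightarrow> 'a \<Rightarrow> enat" where
  "graph_dist G u w = (INF p\<in>{p. is_path G u p w}. enat (length p - 1))"

text \<open>A cycle is given by the list of its vertices in cyclic order.\<close>

definition cycle_edges :: "'a list \<Rightarrow> 'a set set" where
  "cycle_edges c = {{c ! i, c ! (Suc i mod length c)} | i. i < length c}"

definition is_cycle :: "'a graph \<Rightarrow> 'a list \<Rightarrow> bool" where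
  "is_cycle G c \<longleftrightarrow>
     3 \<le> length c \<and> distinct c \<and> set c \<subseteq> verts G \<and> cycle_edges c \<subseteq> edges G"

definition has_chord :: "'a graph \<Rightarrow> 'a list \<Rightarrow> bool" where
  "has_chord G c \<longleftrightarrow>
     (\<exists>x\<in>set c. \<exists>y\<in>set c. x \<noteq> y \<and> {x, y} \<in> edges G \<and> {x, y} \<notin> cycle_edges c)"

definition chordal :: "'a graph \<Rightarrow> bool" where
  "chordal G \<longleftrightarrow> (\<forall>c. is_cycle G c \<and> 4 \<le> length c \<longrightarrow> has_chord G c)"

text \<open>\<open>half_ball G r v\<close> is the ball of radius \<open>r/2\<close> around \<open>v\<close>; the argument \<open>r\<close> is twice
  the radius, so that distance at most \<open>r/2\<close> is expressed without fractions.\<close>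

definition half_ball :: "'a graph \<Rightarrow> nat \<Rightarrow> 'a \<Rightarrow> 'a graph" where
  "half_ball G r v =
     \<lparr>verts = {u \<in> verts G. 2 * graph_dist G u v \<le> enat r},
      edges = {e \<in> edges G. \<exists>u w. e = {u, w} \<and> graph_dist G u v + graph_dist G w v < enat r}\<rparr>"

definition half_ball_set :: "'a graph \<Rightarrow> nat \<Rightarrow> 'a set \<Rightarrow> 'a graph" where
  "half_ball_set G r X = graph_Union (half_ball G r ` X)"

text \<open>The endpoints of every edge of a ball are vertices of the ball, so balls and their
  unions are again graphs.\<close>

lemma graph_dist_le: "is_path G u p w \<Longrightarrow> graph_dist G u w \<le> enat (length p - 1)"
  unfolding graph_dist_def by (rule INF_lower) simp

lemma graph_dist_attained:
  assumes "graph_dist G u w = enat n"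
  shows "\<exists>p. is_path G u p w \<and> length p = Suc n"
proof -
  let ?S = "(\<lambda>p. enat (length p - 1)) ` {p. is_path G u p w}"
  have ne: "?S \<noteq> {}"
  proof
    assume "?S = {}"
    then have "graph_dist G u w = \<infinity>"
      unfolding graph_dist_def by (simp only: Inf_enat_def simp_thms if_True)
    with assms show False by simp
  qed
  have "Inf ?S \<in> ?S"
    using ne unfolding Inf_enat_def by (simp del: image_is_empty) (metis LeastI ex_in_conv)
  then obtain p where "is_path G u p w" "enat (length p - 1) = enat n"
    using assms by (auto simp: graph_dist_def)
  moreover from this have "p \<noteq> []" by (simp add: is_path_def)
  ultimately show ?thesis by (intro exI[of _ p]) (cases p, auto)
qed

lemma graph_dist_step:
  assumes e: "{u, w} \<in> edges G" and w: "w \<in> verts G"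
  shows "graph_dist G w v \<le> graph_dist G u v + 1"
proof (cases "graph_dist G u v")
  case (enat n)
  then obtain p where p: "is_path G u p v" "length p = Suc n"
    using graph_dist_attained[OF enat] by blast
  show ?thesis
  proof (cases "w \<in> set p")
    case True
    then obtain a b where ab: "p = a @ w # b" by (meson split_list)
    have "is_path G w (w # b) v"
      using p ab by (auto simp: is_path_def successively_append_iff)
    from graph_dist_le[OF this] have "graph_dist G w v \<le> enat (length b)" by simp
    also have "\<dots> \<le> enat n + 1" using p ab by (simp add: one_enat_def)
    finally show ?thesis using enat by simp
  next
    case False
    have "is_path G w (w # p) v"
      using p e w False by (auto simp: is_path_def successively_Cons insert_commute)
    from graph_dist_le[OF this] show ?thesis using enat p by (simp add: one_enat_def)
  qed
qed simp

lemma half_ball_edge_end: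
  assumes G: "simple_graph G" and e: "{u, w} \<in> edges G"
    and s: "graph_dist G u v + graph_dist G w v < enat r"
  shows "u \<in> verts (half_ball G r v)"
proof -
  have V: "u \<in> verts G" "w \<in> verts G"
    using G e by (fastforce simp: simple_graph_def doubleton_eq_iff)+
  have le: "graph_dist G u v \<le> graph_dist G w v + 1"
    using graph_dist_step[of w u G v] e V by (simp add: insert_commute)
  obtain a b where ab: "graph_dist G u v = enat a" "graph_dist G w v = enat b"
    using s by (cases "graph_dist G u v"; cases "graph_dist G w v") auto
  have "2 * a \<le> r" using s le ab by (simp add: one_enat_def)
  then have "2 * graph_dist G u v \<le> enat r" using ab by (simp add: numeral_eq_enat)
  with V show ?thesis by (simp add: half_ball_def)
qed

lemma simple_graph_half_ball:
  assumes "simple_graph G"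
  shows "simple_graph (half_ball G r v)"
  unfolding simple_graph_def
proof
  fix e assume "e \<in> edges (half_ball G r v)"
  then obtain u w where e: "e \<in> edges G" "e = {u, w}"
    and s: "graph_dist G u v + graph_dist G w v < enat r"
    by (auto simp: half_ball_def)
  have "u \<noteq> w" using assms e by (fastforce simp: simple_graph_def doubleton_eq_iff)
  moreover have "u \<in> verts (half_ball G r v)"
    using half_ball_edge_end[OF assms _ s] e by simp
  moreover have "w \<in> verts (half_ball G r v)"
    using half_ball_edge_end[OF assms, of w u v r] e s by (simp add: insert_commute add.commute)
  ultimately show "\<exists>u\<in>verts (half_ball G r v). \<exists>w\<in>verts (half_ball G r v). u \<noteq> w \<and> e = {u, w}"
    using e by blast
qed

lemma simple_graph_half_ball_set:
  assumes "simple_graph G"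
  shows "simple_graph (half_ball_set G r X)"
  using simple_graph_half_ball[OF assms, of r]
  unfolding simple_graph_def half_ball_set_def graph_Union_def by fastforce

end

theory Submission imports Defs begin

text \<open>
  Let \<open>S\<^sub>n\<close> be the set of vertices at distance at most \<open>n\<close> from \<open>X\<close>; it is connected because \<open>X\<close>
  is. Take a shortest nontrivial path from \<open>u\<close> to \<open>w\<close> with interior in a connected set. If \<open>u\<close> and \<open>w\<close>
  are adjacent, closing the path by this edge gives a chordless cycle, hence a triangle. If \<open>u\<close> and
  \<open>w\<close> have a common neighbour \<open>x\<close> without neighbours in the set, closing the path through \<open>x\<close> gives
  a cycle of length at least 4 whose only possible chord is \<open>uw\<close>, so \<open>u\<close> and \<open>w\<close> are adjacent.

  For \<open>r = 2k + 1\<close> this gives any two adjacent vertices of \<open>S\<^sub>k\<close> outside \<open>S\<^sub>k\<^sub>-\<^sub>1\<close> a common neighbour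
  in \<open>S\<^sub>k\<^sub>-\<^sub>1\<close>, so that the ball around \<open>X\<close> is the subgraph induced by \<open>S\<^sub>k\<close>.

  For \<open>r = 2k\<close> the ball lacks precisely those edges of \<open>S\<^sub>k\<close> that have both ends outside \<open>S\<^sub>k\<^sub>-\<^sub>1\<close>.
  If \<open>x\<close> is an end of a missing chord of a cycle, both of its neighbours on the cycle are in
  \<open>S\<^sub>k\<^sub>-\<^sub>1\<close>, and they are joined through \<open>S\<^sub>k\<^sub>-\<^sub>2\<close>, which has no neighbour of \<open>x\<close>. Hence they are
  adjacent, and this edge is a chord in the ball.
\<close>

section \<open>Walks and connected vertex sets\<close>

text \<open>Vertices may repeat, so that walks can be concatenated without any shortening.\<close>

definition walk_in :: "'a graph \<Rightarrow> 'a set \<Rightarrow> 'a list \<Rightarrow> bool" where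
  "walk_in G S q \<longleftrightarrow> q \<noteq> [] \<and> set q \<subseteq> S \<and> successively (\<lambda>x y. {x, y} \<in> edges G) q"

definition connected_in :: "'a graph \<Rightarrow> 'a set \<Rightarrow> bool" where
  "connected_in G S \<longleftrightarrow> (\<forall>a\<in>S. \<forall>b\<in>S. \<exists>q. walk_in G S q \<and> hd q = a \<and> last q = b)"

definition vertex_nbhd :: "'a graph \<Rightarrow> 'a set \<Rightarrow> nat \<Rightarrow> 'a set" where
  "vertex_nbhd G X n = {u \<in> verts G. \<exists>v\<in>X. graph_dist G u v \<le> enat n}"

lemma simple_graph_edgeD:
  assumes "simple_graph G" "{u, w} \<in> edges G"
  shows "u \<in> verts G" "w \<in> verts G" "u \<noteq> w"
  using assms by (fastforce simp: simple_graph_def doubleton_eq_iff)+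

section \<open>Induced cycles and induced paths\<close>

text \<open>The edge between the ends closes the list to a cycle, and every edge of \<open>G\<close>
  between its vertices is a cycle edge. With at least four vertices such a cycle would lack a
  chord.\<close>

lemma chordal_induced_cycle_length:
  assumes "chordal G" "distinct c" "set c \<subseteq> verts G"
    and edges: "\<And>i. Suc i < length c \<Longrightarrow> {c ! i, c ! Suc i} \<in> edges G"
    and closing: "{c ! 0, c ! (length c - 1)} \<in> edges G"
    and induced: "\<And>i j. i < j \<Longrightarrow> j < length c \<Longrightarrow> {c ! i, c ! j} \<in> edges G \<Longrightarrow>
      j = Suc i \<or> i = 0 \<and> j = length c - 1"
  shows "length c < 4"
proof (rule ccontr)
  assume "\<not> length c < 4"
  then have len: "4 \<le> length c" by simp
  have step: "{c ! i, c ! (Suc i mod length c)} \<in> edges G" if "i < length c" for i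
  proof (cases "Suc i = length c")
    case True
    then have "i = length c - 1" by simp
    with True closing show ?thesis by (simp add: insert_commute)
  next
    case False
    with that edges[of i] show ?thesis by simp
  qed
  have "is_cycle G c"
    using assms(2,3) len step by (auto simp: is_cycle_def cycle_edges_def)
  with \<open>chordal G\<close> len have "has_chord G c" by (simp add: chordal_def)
  then obtain x y where xy: "x \<in> set c" "y \<in> set c" "x \<noteq> y" "{x, y} \<in> edges G"
    "{x, y} \<notin> cycle_edges c"
    by (auto simp: has_chord_def)
  obtain i j where ij: "i < length c" "j < length c" "x = c ! i" "y = c ! j"
    using xy by (metis in_set_conv_nth)
  have no: "{c ! i, c ! j} \<in> cycle_edges c"
    if h: "i < j" "j < length c" "{c ! i, c ! j} \<in> edges G" for i j
    using induced[OF h]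
  proof
    assume "j = Suc i"
    with h show ?thesis by (auto simp: cycle_edges_def intro!: exI[of _ i])
  next
    assume *: "i = 0 \<and> j = length c - 1"
    then have "Suc j = length c" using len by auto
    then have "Suc j mod length c = i" using * by simp
    with h * show ?thesis
      unfolding cycle_edges_def by (smt (verit) insert_commute mem_Collect_eq)
  qed
  show False
  proof (cases "i < j")
    case True
    with no[of i j] xy ij show False by simp
  next
    case False
    with ij xy have "j < i" by (metis linorder_neqE_nat)
    with no[of j i] xy ij show False by (simp add: insert_commute)
  qed
qed

text \<open>The pair of ends is exempt from the conclusion: \<open>u\<close> and \<open>w\<close> may be adjacent.\<close>

lemma connected_in_obtain_induced_path:
  assumes "connected_in G S" "u \<noteq> w" "u \<notin> S" "w \<notin> S"
    and a: "a \<in> S" "{u, a} \<in> edges G" and b: "b \<in> S" "{w, b} \<in> edges G"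
  obtains p where "3 \<le> length p" "p ! 0 = u" "p ! (length p - 1) = w" "distinct p"
    "\<And>i. 0 < i \<Longrightarrow> i < length p - 1 \<Longrightarrow> p ! i \<in> S"
    "\<And>i. Suc i < length p \<Longrightarrow> {p ! i, p ! Suc i} \<in> edges G"
    "\<And>i j. i < j \<Longrightarrow> j < length p \<Longrightarrow> {p ! i, p ! j} \<in> edges G \<Longrightarrow>
      j = Suc i \<or> i = 0 \<and> j = length p - 1"
proof -
  \<comment> \<open>Distinctness is left out of \<open>P\<close>: it follows from minimality, and
    \<open>P\<close> stays easy to check after a shortcut.\<close>
  define P where "P p \<longleftrightarrow> 3 \<le> length p \<and> p ! 0 = u \<and> p ! (length p - 1) = w \<and>
    (\<forall>i. 0 < i \<and> i < length p - 1 \<longrightarrow> p ! i \<in> S) \<and>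
    (\<forall>i. Suc i < length p \<longrightarrow> {p ! i, p ! Suc i} \<in> edges G)" for p
  obtain q where q: "walk_in G S q" "hd q = a" "last q = b"
    using assms(1) a b by (auto simp: connected_in_def)
  have "P (u # q @ [w])"
  proof -
    have ne: "q \<noteq> []" using q by (simp add: walk_in_def)
    then have len: "3 \<le> length (u # q @ [w])" by (cases q) auto
    have "successively (\<lambda>x y. {x, y} \<in> edges G) (u # q @ [w])"
      using q ne a b
      by (auto simp: walk_in_def successively_Cons successively_append_iff insert_commute)
    then have "\<forall>i. Suc i < length (u # q @ [w]) \<longrightarrow>
      {(u # q @ [w]) ! i, (u # q @ [w]) ! Suc i} \<in> edges G"
      by (simp add: successively_conv_nth)
    moreover have "\<forall>i. 0 < i \<and> i < length (u # q @ [w]) - 1 \<longrightarrow> (u # q @ [w]) ! i \<in> S"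
      using q by (auto simp: walk_in_def nth_Cons nth_append subset_iff split: nat.splits)
    ultimately show ?thesis using len by (simp add: P_def nth_append)
  qed
  then obtain p where p: "P p" and min: "\<And>p'. P p' \<Longrightarrow> length p \<le> length p'"
    using ex_has_least_nat[of P _ length] by metis
  have len: "3 \<le> length p" and hd: "p ! 0 = u" and lst: "p ! (length p - 1) = w"
    and int: "\<And>i. 0 < i \<Longrightarrow> i < length p - 1 \<Longrightarrow> p ! i \<in> S"
    and edg: "\<And>i. Suc i < length p \<Longrightarrow> {p ! i, p ! Suc i} \<in> edges G"
    using p by (auto simp: P_def)
  \<comment> \<open>Cutting out the positions from \<open>m\<close> to \<open>j - 1\<close>
    preserves every clause of \<open>P\<close> except possibly the length bound, so by minimality
    that bound must fail.\<close>
  have shortcut: "m + length p - j < 3"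
    if h: "0 < m" "m < j" "j < length p" "{p ! (m - 1), p ! j} \<in> edges G" for m j
  proof (rule ccontr)
    assume l3: "\<not> m + length p - j < 3"
    let ?p = "take m p @ drop j p"
    have lp: "length ?p = m + length p - j" using h by simp
    have nth: "?p ! i = (if i < m then p ! i else p ! (i - m + j))" if "i < length ?p" for i
      using that h by (auto simp: nth_append add.commute)
    have "P ?p"
      unfolding P_def
    proof (intro conjI allI impI)
      show "3 \<le> length ?p" using l3 lp by simp
      show "?p ! 0 = u" using h hd by (simp add: nth_append)
      have "length ?p - 1 - m + j = length p - 1" "\<not> length ?p - 1 < m" using h lp by auto
      then show "?p ! (length ?p - 1) = w" using nth[of "length ?p - 1"] l3 lp lst by auto
    next
      fix i assume i: "0 < i \<and> i < length ?p - 1"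
      then show "?p ! i \<in> S" using nth[of i] int[of i] int[of "i - m + j"] h lp by auto
    next
      fix i assume i: "Suc i < length ?p"
      consider "Suc i < m" | "Suc i = m" | "m \<le> i" by linarith
      then show "{?p ! i, ?p ! Suc i} \<in> edges G"
      proof cases
        case 1
        then show ?thesis using nth[of i] nth[of "Suc i"] i edg[of i] h by simp
      next
        case 2
        then show ?thesis using nth[of i] nth[of "Suc i"] i h by auto
      next
        case 3
        then show ?thesis
          using nth[of i] nth[of "Suc i"] i edg[of "i - m + j"] h lp by (simp add: Suc_diff_le)
      qed
    qed
    from min[OF this] show False using lp h by simp
  qed
  have "distinct p"
  proof -
    have "p ! i \<noteq> p ! j" if h: "i < j" "j < length p" for i j
    proof
      assume eq: "p ! i = p ! j"
      have "i \<noteq> 0"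
      proof
        assume "i = 0"
        then have "p ! j = u" using eq hd by simp
        moreover from this have "j \<noteq> length p - 1" using lst assms(2) by auto
        then have "j < length p - 1" using h by linarith
        ultimately show False using int[of j] h assms(3) by auto
      qed
      moreover have "j \<noteq> length p - 1"
      proof
        assume "j = length p - 1"
        then show False using int[of i] h lst eq \<open>i \<noteq> 0\<close> assms(4) by auto
      qed
      \<comment> \<open>The edge into position \<open>i\<close> also leads to position
        \<open>j\<close>. At least one vertex remains before the cut and at least two from
        \<open>j\<close> on, against \<open>shortcut\<close>.\<close>
      ultimately show False
        using shortcut[of i j] edg[of "i - 1"] eq h by auto
    qed
    then show ?thesis by (metis distinct_conv_nth linorder_neqE_nat)
  qed
  \<comment> \<open>An edge that skips vertices is possible only if the shortcut leaves just the two
    ends.\<close>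
  moreover have "j = Suc i \<or> i = 0 \<and> j = length p - 1"
    if "i < j" "j < length p" "{p ! i, p ! j} \<in> edges G" for i j
    using shortcut[of "Suc i" j] that by (cases "j = Suc i") auto
  ultimately show thesis using that len hd lst int edg by blast
qed

text \<open>The induced path closed by \<open>uw\<close> must be a triangle, and \<open>t\<close> is
  the single interior vertex of the path. For odd \<open>r\<close> this vertex shows that
  \<open>uw\<close> belongs to the ball.\<close>

lemma adjacent_common_neighbour_in:
  assumes "simple_graph G" "chordal G" "connected_in G S" "u \<notin> S" "w \<notin> S"
    and "a \<in> S" "{u, a} \<in> edges G" "b \<in> S" "{w, b} \<in> edges G"
    and uw: "{u, w} \<in> edges G"
  obtains t where "t \<in> S" "{u, t} \<in> edges G" "{w, t} \<in> edges G"
proof -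
  have "u \<noteq> w" using simple_graph_edgeD[OF assms(1) uw] by simp
  from connected_in_obtain_induced_path[OF assms(3) this assms(4-9)]
  obtain p where p: "3 \<le> length p" "p ! 0 = u" "p ! (length p - 1) = w" "distinct p"
    "\<And>i. 0 < i \<Longrightarrow> i < length p - 1 \<Longrightarrow> p ! i \<in> S"
    "\<And>i. Suc i < length p \<Longrightarrow> {p ! i, p ! Suc i} \<in> edges G"
    "\<And>i j. i < j \<Longrightarrow> j < length p \<Longrightarrow> {p ! i, p ! j} \<in> edges G \<Longrightarrow>
      j = Suc i \<or> i = 0 \<and> j = length p - 1"
    by metis
  \<comment> \<open>Each vertex of the path is an end of one of its edges.\<close>
  have "p ! i \<in> verts G" if "i < length p" for i
    using that p(1) p(6)[of i] p(6)[of "i - 1"] simple_graph_edgeD[OF assms(1)]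
    by (cases "Suc i < length p") (fastforce)+
  then have "set p \<subseteq> verts G" by (auto simp: in_set_conv_nth)
  from chordal_induced_cycle_length[OF assms(2) p(4) this p(6) _ p(7)] p(1-3) uw
  have "length p = 3" by fastforce
  then show thesis
    using p(5)[of 1] p(6)[of 0] p(6)[of 1] p(2,3) that[of "p ! 1"]
    by (simp add: insert_commute numeral_2_eq_2)
qed

text \<open>Among the vertices of the induced path, \<open>x\<close> is adjacent only to the ends.
  If these were not adjacent, \<open>x\<close> would close the path to an induced cycle of length at
  least 4.\<close>

lemma neighbours_adjacent:
  assumes "simple_graph G" "chordal G" "connected_in G S" "u \<noteq> w" "u \<notin> S" "w \<notin> S"
    and "a \<in> S" "{u, a} \<in> edges G" "b \<in> S" "{w, b} \<in> edges G"
    and xu: "{x, u} \<in> edges G" and xw: "{x, w} \<in> edges G"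
    and "x \<notin> S" and xS: "\<And>s. s \<in> S \<Longrightarrow> {x, s} \<notin> edges G"
  shows "{u, w} \<in> edges G"
proof (rule ccontr)
  assume uw: "{u, w} \<notin> edges G"
  from connected_in_obtain_induced_path[OF assms(3-10)]
  obtain p where p: "3 \<le> length p" "p ! 0 = u" "p ! (length p - 1) = w" "distinct p"
    "\<And>i. 0 < i \<Longrightarrow> i < length p - 1 \<Longrightarrow> p ! i \<in> S"
    "\<And>i. Suc i < length p \<Longrightarrow> {p ! i, p ! Suc i} \<in> edges G"
    "\<And>i j. i < j \<Longrightarrow> j < length p \<Longrightarrow> {p ! i, p ! j} \<in> edges G \<Longrightarrow>
      j = Suc i \<or> i = 0 \<and> j = length p - 1"
    by metis
  note V = simple_graph_edgeD[OF assms(1)]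
  have pV: "p ! i \<in> verts G" if "i < length p" for i
    using that p(1) p(6)[of i] p(6)[of "i - 1"] V
    by (cases "Suc i < length p") (fastforce)+
  have px: "p ! i \<noteq> x" if "i < length p" for i
  proof (cases "i = 0 \<or> i = length p - 1")
    case True
    then show ?thesis using V(3)[OF xu] V(3)[OF xw] p(2,3) by auto
  next
    case False
    then have "0 < i" "i < length p - 1" using that by linarith+
    then have "p ! i \<in> S" by (rule p(5))
    with \<open>x \<notin> S\<close> show ?thesis by auto
  qed
  have "length (x # p) < 4"
  proof (rule chordal_induced_cycle_length[OF assms(2)])
    show "distinct (x # p)" using px p(4) by (auto simp: in_set_conv_nth)
    show "set (x # p) \<subseteq> verts G" using pV V(1)[OF xu] by (auto simp: in_set_conv_nth)
    show "{(x # p) ! i, (x # p) ! Suc i} \<in> edges G" if "Suc i < length (x # p)" for i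
      using that p(2) p(6)[of "i - 1"] xu by (cases i) auto
    show "{(x # p) ! 0, (x # p) ! (length (x # p) - 1)} \<in> edges G"
      using xw p(1,3) by (auto simp: nth_Cons')
    fix i j
    assume h: "i < j" "j < length (x # p)" "{(x # p) ! i, (x # p) ! j} \<in> edges G"
    obtain j' where j: "j = Suc j'" using h by (cases j) auto
    show "j = Suc i \<or> i = 0 \<and> j = length (x # p) - 1"
    proof (cases i)
      case 0
      then have "p ! j' \<notin> S" using h j xS by auto
      then have "j' = 0 \<or> j' = length p - 1" using p(5)[of j'] h j by fastforce
      then show ?thesis using 0 j p(1) by auto
    next
      case (Suc i')
      then have "j' = Suc i' \<or> i' = 0 \<and> j' = length p - 1" using p(7)[of i' j'] h j by auto
      \<comment> \<open>The pair of ends exempted for the path is \<open>u\<close> and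
        \<open>w\<close>, excluded by \<open>uw\<close>.\<close>
      then show ?thesis using Suc j h uw p(2,3) by auto
    qed
  qed
  then show False using p(1) by simp
qed

section \<open>Neighbourhoods of a vertex set\<close>

lemma vertex_nbhd_mono: "m \<le> n \<Longrightarrow> vertex_nbhd G X m \<subseteq> vertex_nbhd G X n"
  by (fastforce simp: vertex_nbhd_def intro: order_trans)

lemma vertex_nbhd_neighbour:
  assumes "simple_graph G" "u \<in> vertex_nbhd G X n" "{u, w} \<in> edges G"
  shows "w \<in> vertex_nbhd G X (Suc n)"
proof -
  note V = simple_graph_edgeD[OF assms(1,3)]
  obtain v where v: "v \<in> X" "graph_dist G u v \<le> enat n" using assms by (auto simp: vertex_nbhd_def)
  have "graph_dist G w v \<le> graph_dist G u v + 1" using graph_dist_step assms(3) V by metis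
  also have "\<dots> \<le> enat n + 1" using v by (simp add: add_right_mono)
  finally show ?thesis using V v by (auto simp: vertex_nbhd_def one_enat_def)
qed

text \<open>The second vertex of a shortest path to \<open>X\<close> is one step closer.\<close>

lemma vertex_nbhd_SucE:
  assumes "u \<in> vertex_nbhd G X (Suc n)" "u \<notin> vertex_nbhd G X n"
  obtains t where "t \<in> vertex_nbhd G X n" "{u, t} \<in> edges G"
proof -
  obtain v where v: "v \<in> X" "graph_dist G u v \<le> enat (Suc n)" and u: "u \<in> verts G"
    using assms by (auto simp: vertex_nbhd_def)
  have "\<not> graph_dist G u v \<le> enat n" using assms u v by (auto simp: vertex_nbhd_def)
  then have "graph_dist G u v = enat (Suc n)" using v by (cases "graph_dist G u v") auto
  from graph_dist_attained[OF this] obtain p where p: "is_path G u p v" "length p = Suc (Suc n)"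
    by blast
  then obtain t q where pq: "p = u # t # q" by (cases p; cases "tl p") (auto simp: is_path_def)
  have "is_path G t (t # q) v" "{u, t} \<in> edges G" "t \<in> verts G"
    using p pq by (auto simp: is_path_def)
  moreover from graph_dist_le[OF this(1)] have "graph_dist G t v \<le> enat n" using p pq by simp
  ultimately show thesis using that v by (auto simp: vertex_nbhd_def)
qed

lemma graph_dist_self: "v \<in> verts G \<Longrightarrow> graph_dist G v v = 0"
  using graph_dist_le[of G v "[v]" v] by (simp add: is_path_def zero_enat_def[symmetric])

lemma vertex_nbhd_0:
  assumes "X \<subseteq> verts G"
  shows "vertex_nbhd G X 0 = X"
proof
  show "vertex_nbhd G X 0 \<subseteq> X"
  proof
    fix u assume "u \<in> vertex_nbhd G X 0"
    then obtain v where v: "v \<in> X" "graph_dist G u v = enat 0"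
      by (auto simp: vertex_nbhd_def zero_enat_def[symmetric])
    from graph_dist_attained[OF v(2)] have "u = v" by (auto simp: is_path_def length_Suc_conv)
    with v show "u \<in> X" by simp
  qed
  show "X \<subseteq> vertex_nbhd G X 0"
    using assms by (auto simp: vertex_nbhd_def zero_enat_def[symmetric] intro!: graph_dist_self)
qed

text \<open>By induction: two vertices of the larger neighbourhood are linked by descending into the
  smaller one, crossing it and climbing back.\<close>

lemma connected_in_vertex_nbhd:
  assumes "X \<subseteq> verts G" "connected_graph (induced_subgraph G X)"
  shows "connected_in G (vertex_nbhd G X n)"
proof (induction n)
  case 0
  have "\<exists>q. walk_in G X q \<and> hd q = a \<and> last q = b" if ab: "a \<in> X" "b \<in> X" for a b
  proof -
    obtain q where q: "is_path (induced_subgraph G X) a q b"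
      using ab assms unfolding connected_graph_def by (fastforce simp: induced_subgraph_def)
    then have "successively (\<lambda>x y. {x, y} \<in> edges G) q"
      by (auto simp: is_path_def induced_subgraph_def elim: successively_mono)
    with q show ?thesis by (auto simp: is_path_def induced_subgraph_def walk_in_def)
  qed
  then show ?case by (simp add: connected_in_def vertex_nbhd_0[OF assms(1)])
next
  case (Suc n)
  let ?S = "vertex_nbhd G X n" and ?T = "vertex_nbhd G X (Suc n)"
  have sub: "?S \<subseteq> ?T" by (simp add: vertex_nbhd_mono)
  have down: "\<exists>q a'. walk_in G ?T q \<and> hd q = a \<and> last q = a' \<and> a' \<in> ?S" if "a \<in> ?T" for a
  proof (cases "a \<in> ?S")
    case True
    then show ?thesis using that by (intro exI[of _ "[a]"] exI[of _ a]) (simp add: walk_in_def)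
  next
    case False
    with that obtain t where "t \<in> ?S" "{a, t} \<in> edges G" by (rule vertex_nbhd_SucE)
    then show ?thesis
      using that sub by (intro exI[of _ "[a, t]"] exI[of _ t]) (auto simp: walk_in_def)
  qed
  have rev: "walk_in G ?T (rev q)" if "walk_in G ?T q" for q
    using that by (simp add: walk_in_def insert_commute)
  \<comment> \<open>\<open>tl\<close> drops the shared vertex, which would otherwise stand next to
    itself.\<close>
  have join: "walk_in G ?T (q @ tl q')" "hd (q @ tl q') = hd q" "last (q @ tl q') = last q'"
    if "walk_in G ?T q" "walk_in G ?T q'" "last q = hd q'" for q q'
    using that
    by (cases q'; auto simp: walk_in_def successively_append_iff successively_Cons)+
  show ?case
    unfolding connected_in_def
  proof (intro ballI)
    fix a b assume "a \<in> ?T" "b \<in> ?T"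
    then obtain p a' q b' where p: "walk_in G ?T p" "hd p = a" "last p = a'" "a' \<in> ?S"
      and q: "walk_in G ?T q" "hd q = b" "last q = b'" "b' \<in> ?S"
      using down by meson
    obtain m where m: "walk_in G ?S m" "hd m = a'" "last m = b'"
      using Suc.IH p q by (auto simp: connected_in_def)
    have mT: "walk_in G ?T m" using m sub by (auto simp: walk_in_def)
    note j = join[OF mT rev[OF q(1)]]
    have ne: "q \<noteq> []" using q by (simp add: walk_in_def)
    then have e: "last m = hd (rev q)" using m q by (simp add: hd_rev)
    have "last p = hd (m @ tl (rev q))" using j(2)[OF e] p m by simp
    note k = join[OF p(1) j(1)[OF e] this]
    show "\<exists>q. walk_in G ?T q \<and> hd q = a \<and> last q = b"
      using k j(3)[OF e] p q ne by (metis last_rev)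
  qed
qed

section \<open>Vertices and edges of the ball around a set\<close>

lemma verts_half_ball_set: "verts (half_ball_set G r X) = vertex_nbhd G X (r div 2)"
proof -
  have "2 * d \<le> enat r \<longleftrightarrow> d \<le> enat (r div 2)" for d
    by (cases d) (auto simp: numeral_eq_enat)
  then show ?thesis by (auto simp: half_ball_set_def graph_Union_def half_ball_def vertex_nbhd_def)
qed

lemma edge_half_ball_set_iff:
  "{u, w} \<in> edges (half_ball_set G r X) \<longleftrightarrow>
    {u, w} \<in> edges G \<and> (\<exists>v\<in>X. graph_dist G u v + graph_dist G w v < enat r)"
  by (auto simp: half_ball_set_def graph_Union_def half_ball_def doubleton_eq_iff add.commute)

text \<open>The other end is at distance at most \<open>n + 1\<close> from the same centre, so the
  two distances sum to at most \<open>2 * n + 1\<close>.\<close>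

lemma edge_half_ball_setI:
  assumes "simple_graph G" "{u, w} \<in> edges G" "u \<in> vertex_nbhd G X n" "2 * n + 1 < r"
  shows "{u, w} \<in> edges (half_ball_set G r X)"
proof -
  obtain v where v: "v \<in> X" "graph_dist G u v \<le> enat n" using assms by (auto simp: vertex_nbhd_def)
  have "graph_dist G w v \<le> graph_dist G u v + 1"
    using graph_dist_step[OF assms(2)] simple_graph_edgeD[OF assms(1,2)] by simp
  then have "graph_dist G u v + graph_dist G w v < enat r"
    using v assms(4) by (cases "graph_dist G u v"; cases "graph_dist G w v") (auto simp: one_enat_def)
  then show ?thesis using assms v by (auto simp: edge_half_ball_set_iff)
qed

section \<open>Odd \<open>r\<close>\<close>

lemma chordal_induced_subgraph:
  assumes "chordal G"
  shows "chordal (induced_subgraph G S)"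
  unfolding chordal_def
proof (intro allI impI)
  fix c assume c: "is_cycle (induced_subgraph G S) c \<and> 4 \<le> length c"
  then have "is_cycle G c" by (auto simp: is_cycle_def induced_subgraph_def)
  with assms c have "has_chord G c" by (simp add: chordal_def)
  with c show "has_chord (induced_subgraph G S) c"
    by (fastforce simp: has_chord_def is_cycle_def induced_subgraph_def)
qed

text \<open>The critical edges join two vertices at distance \<open>n + 1\<close> from
  \<open>X\<close>, which a priori may have no nearest vertex of \<open>X\<close> in common. A
  common neighbour closer to \<open>X\<close> provides one, and the distances then sum to at most
  \<open>2 * n + 2\<close>, below \<open>r = 2 * n + 3\<close>.\<close>

lemma half_ball_set_odd_eq_induced_subgraph:
  assumes "simple_graph G" "chordal G" "X \<subseteq> verts G" "connected_graph (induced_subgraph G X)"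
  shows "half_ball_set G (2 * Suc n + 1) X = induced_subgraph G (vertex_nbhd G X (Suc n))"
proof -
  let ?B = "half_ball_set G (2 * Suc n + 1) X" and ?S = "vertex_nbhd G X n"
    and ?T = "vertex_nbhd G X (Suc n)"
  have "verts ?B = ?T" by (simp only: verts_half_ball_set) simp
  then have V: "verts ?B = verts G \<inter> ?T" by (auto simp: vertex_nbhd_def)
  have in_B: "{u, w} \<in> edges ?B" if e: "{u, w} \<in> edges G" and uw: "u \<in> ?T" "w \<in> ?T" for u w
  proof (cases "u \<in> ?S \<or> w \<in> ?S")
    case True
    then show ?thesis
      using edge_half_ball_setI[OF assms(1), of u w X n] edge_half_ball_setI[OF assms(1), of w u X n] e
      by (auto simp: insert_commute)
  next
    case False
    then obtain a b where "a \<in> ?S" "{u, a} \<in> edges G" "b \<in> ?S" "{w, b} \<in> edges G"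
      using uw vertex_nbhd_SucE by metis
    then obtain t where t: "t \<in> ?S" "{u, t} \<in> edges G" "{w, t} \<in> edges G"
      using adjacent_common_neighbour_in[OF assms(1,2) connected_in_vertex_nbhd[OF assms(3,4)]]
        False e by metis
    obtain v where v: "v \<in> X" "graph_dist G t v \<le> enat n" using t by (auto simp: vertex_nbhd_def)
    have "graph_dist G u v \<le> graph_dist G t v + 1" "graph_dist G w v \<le> graph_dist G t v + 1"
      using graph_dist_step[of t u G v] graph_dist_step[of t w G v] t simple_graph_edgeD[OF assms(1)]
      by (auto simp: insert_commute)
    then have "graph_dist G u v + graph_dist G w v < enat (2 * Suc n + 1)"
      using v
      by (cases "graph_dist G u v"; cases "graph_dist G w v"; cases "graph_dist G t v")
        (auto simp: one_enat_def)
    then show ?thesis using e v edge_half_ball_set_iff by metis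
  qed
  have "e \<in> edges ?B \<longleftrightarrow> e \<in> edges G \<and> e \<subseteq> ?T" for e
  proof
    assume e: "e \<in> edges ?B"
    then obtain u w where uw: "u \<in> verts ?B" "w \<in> verts ?B" "e = {u, w}"
      using simple_graph_half_ball_set[OF assms(1)] unfolding simple_graph_def by metis
    then show "e \<in> edges G \<and> e \<subseteq> ?T" using e V edge_half_ball_set_iff by fastforce
  next
    assume e: "e \<in> edges G \<and> e \<subseteq> ?T"
    then obtain u w where "e = {u, w}" using assms(1) unfolding simple_graph_def by metis
    then show "e \<in> edges ?B" using e in_B by auto
  qed
  then have "edges ?B = {e \<in> edges G. e \<subseteq> ?T}" by blast
  with V show ?thesis by (simp add: induced_subgraph_def)
qed

section \<open>Even \<open>r\<close>\<close>

text \<open>The two neighbours of \<open>x\<close> on the cycle are two positions apart, which makes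
  them consecutive only in a triangle.\<close>

lemma cycle_obtain_neighbours:
  assumes "distinct c" "4 \<le> length c" "x \<in> set c"
  obtains z z' where "z \<in> set c" "z' \<in> set c" "z \<noteq> z'" "{x, z} \<in> cycle_edges c"
    "{x, z'} \<in> cycle_edges c" "{z, z'} \<notin> cycle_edges c"
proof -
  let ?n = "length c"
  obtain i where i: "i < ?n" "x = c ! i" using assms by (metis in_set_conv_nth)
  define s where "s = Suc i mod ?n"
  define t where "t = (if i = 0 then ?n - 1 else i - 1)"
  have s: "s = (if Suc i = ?n then 0 else Suc i)" using i by (simp add: s_def)
  have st: "s < ?n" "t < ?n" "s \<noteq> t" "Suc t mod ?n = i"
    using assms(2) i s by (auto simp: t_def)
  have no: "{s, t} \<noteq> {l, Suc l mod ?n}" if "l < ?n" for l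
  proof -
    have "Suc l mod ?n = (if Suc l = ?n then 0 else Suc l)" using that by simp
    then show ?thesis using assms(2) i s
      by (auto simp: doubleton_eq_iff t_def split: if_splits)
  qed
  have "{c ! s, c ! t} \<notin> cycle_edges c"
  proof
    assume "{c ! s, c ! t} \<in> cycle_edges c"
    then obtain l where l: "l < ?n" "{c ! s, c ! t} = {c ! l, c ! (Suc l mod ?n)}"
      by (auto simp: cycle_edges_def)
    moreover have "Suc l mod ?n < ?n" using l by (intro mod_less_divisor) linarith
    ultimately show False
      using no[OF l(1)] st assms(1) by (auto simp: doubleton_eq_iff nth_eq_iff_index_eq)
  qed
  moreover have "{x, c ! s} \<in> cycle_edges c" using i s_def by (auto simp: cycle_edges_def)
  moreover have "{c ! t, x} \<in> cycle_edges c" using i st by (auto simp: cycle_edges_def)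
  moreover have "c ! s \<noteq> c ! t" using st assms(1) by (simp add: nth_eq_iff_index_eq)
  ultimately show thesis using that[of "c ! s" "c ! t"] st by (simp add: insert_commute)
qed

lemma chordal_half_ball_set_even:
  assumes "simple_graph G" "chordal G" "X \<subseteq> verts G" "connected_graph (induced_subgraph G X)"
  shows "chordal (half_ball_set G (2 * Suc (Suc n)) X)"
  unfolding chordal_def
proof (intro allI impI)
  \<comment> \<open>With \<open>k = n + 2\<close>, \<open>?S\<close> is
    \<open>S\<^sub>k\<^sub>-\<^sub>2\<close> and \<open>?T\<close> is
    \<open>S\<^sub>k\<^sub>-\<^sub>1\<close>.\<close>
  let ?B = "half_ball_set G (2 * Suc (Suc n)) X" and ?S = "vertex_nbhd G X n"
    and ?T = "vertex_nbhd G X (Suc n)"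
  fix c assume c: "is_cycle ?B c \<and> 4 \<le> length c"
  have eG: "e \<in> edges G" if "e \<in> edges ?B" for e
    using that by (auto simp: half_ball_set_def graph_Union_def half_ball_def)
  have "verts ?B \<subseteq> verts G" by (auto simp: verts_half_ball_set vertex_nbhd_def)
  then have "is_cycle G c" using c eG by (auto simp: is_cycle_def)
  with assms(2) c have "has_chord G c" by (simp add: chordal_def)
  then obtain x y where xy: "x \<in> set c" "y \<in> set c" "x \<noteq> y" "{x, y} \<in> edges G"
    "{x, y} \<notin> cycle_edges c"
    by (auto simp: has_chord_def)
  show "has_chord ?B c"
  proof (cases "x \<in> ?T")
    case True
    then have "{x, y} \<in> edges ?B" using edge_half_ball_setI[OF assms(1) xy(4) True, of "2 * Suc (Suc n)"] by simp
    then show ?thesis using xy by (auto simp: has_chord_def)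
  next
    case False
    \<comment> \<open>Now \<open>x\<close> is at distance exactly \<open>n + 2\<close> from
      \<open>X\<close> and \<open>xy\<close> may be missing from the ball; the neighbours of
      \<open>x\<close> on the cycle supply another chord.\<close>
    obtain z z' where z: "z \<in> set c" "z' \<in> set c" "z \<noteq> z'" "{x, z} \<in> cycle_edges c"
      "{x, z'} \<in> cycle_edges c" "{z, z'} \<notin> cycle_edges c"
      using cycle_obtain_neighbours[of c x] c xy by (auto simp: is_cycle_def)
    \<comment> \<open>Every member of \<open>X\<close> is at distance at least \<open>n + 2\<close>
      from \<open>x\<close>, so the bound \<open>2 * n + 4\<close> leaves at most
      \<open>n + 1\<close> for \<open>u\<close>. If \<open>u\<close> were in \<open>?S\<close>, then
      \<open>x\<close> would be in \<open>?T\<close>.\<close>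
    have nb: "u \<in> ?T \<and> u \<notin> ?S \<and> {x, u} \<in> edges G" if "{x, u} \<in> cycle_edges c" for u
    proof -
      have "{x, u} \<in> edges ?B" using that c by (auto simp: is_cycle_def)
      then obtain v where v: "v \<in> X" "{x, u} \<in> edges G"
        "graph_dist G x v + graph_dist G u v < enat (2 * Suc (Suc n))"
        unfolding edge_half_ball_set_iff by blast
      note V = simple_graph_edgeD[OF assms(1) v(2)]
      have "\<not> graph_dist G x v \<le> enat (Suc n)" using False v V by (auto simp: vertex_nbhd_def)
      then have "graph_dist G u v \<le> enat (Suc n)"
        using v(3) by (cases "graph_dist G x v"; cases "graph_dist G u v") auto
      then have "u \<in> ?T" using v V by (auto simp: vertex_nbhd_def)
      moreover have "u \<notin> ?S"
        using vertex_nbhd_neighbour[OF assms(1), of u X n x] False v by (auto simp: insert_commute)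
      ultimately show ?thesis using v by simp
    qed
    note nz = nb[OF z(4)] nb[OF z(5)]
    obtain a b where ab: "a \<in> ?S" "{z, a} \<in> edges G" "b \<in> ?S" "{z', b} \<in> edges G"
      using nz vertex_nbhd_SucE by metis
    have "{x, s} \<notin> edges G" if "s \<in> ?S" for s
      using vertex_nbhd_neighbour[OF assms(1) that, of x] False by (auto simp: insert_commute)
    moreover have "x \<notin> ?S" using False vertex_nbhd_mono[of n "Suc n" G X] by auto
    ultimately have "{z, z'} \<in> edges G"
      using neighbours_adjacent[OF assms(1,2) connected_in_vertex_nbhd[OF assms(3,4)] z(3) _ _ ab]
        nz by blast
    then have "{z, z'} \<in> edges ?B"
      using edge_half_ball_setI[OF assms(1), of z z' X "Suc n" "2 * Suc (Suc n)"] nz by simp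
    then show ?thesis using z by (auto simp: has_chord_def)
  qed
qed

theorem theorem2p2:
  fixes G :: "'a graph" and r :: nat and X :: "'a set"
  assumes "simple_graph G"
    and "chordal G"
    and "r \<ge> 3"
    and "X \<subseteq> verts G"
    and "connected_graph (induced_subgraph G X)"
  shows "chordal (half_ball_set G r X)"
proof (cases "even r")
  case True
  then obtain k where "r = 2 * k" by blast
  \<comment> \<open>An even \<open>r\<close> that is at least 3 is at least 4, so \<open>k\<close>
    is at least 2 and \<open>S\<^sub>k\<^sub>-\<^sub>2\<close> makes sense.\<close>
  moreover from this obtain n where "k = Suc (Suc n)"
    using assms(3) by (cases k; cases "k - 1") auto
  ultimately show ?thesis using chordal_half_ball_set_even[OF assms(1,2,4,5)] by simp
next
  case False
  then obtain k where "r = 2 * k + 1" by (blast elim: oddE)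
  moreover from this obtain n where "k = Suc n" using assms(3) by (cases k) auto
  ultimately show ?thesis
    using half_ball_set_odd_eq_induced_subgraph[OF assms(1,2,4,5)] chordal_induced_subgraph[OF assms(2)]
    by simp
qed

end
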